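(* Let $m\ge 4$ be even and let $\alpha^*(m)=\max \Omega(m)$ be the Sup-MO value. For each integer $n\ge 1$ let $\mathcal{A}(n,m;\alpha^*(m))=\mathcal{M}(n,m)-\alpha^*(m)\,\mathcal{N}(n,m)$ be the Sup-MO tensor, i.e. the real symmetric tensor of order $m$ and dimension $n$ with entries $$\mathcal{A}(n,m;\alpha^*(m))_{i_1,\dots,i_m}=\begin{cases} i_1, & i_1=i_2=\cdots=i_m,\\ \min\{i_1,\dots,i_m\}-\alpha^*(m), & \text{otherwise},\end{cases}\qquad i_1,\dots,i_m\in\{1,\dots,n\}.$$ Let $\lambda_{\min}(\mathcal{A}(n,m;\alpha^*(m)))$ denote the smallest H-eigenvalue of $\mathcal{A}(n,m;\alpha^*(m))$. Then $\lambda_{\min}(\mathcal{A}(n,m;\alpha^*(m)))$ is strictly decreasing in $n$ and converges to $0$ as $n\to\infty$. Furthermore, $\mathcal{A}(n,m;\alpha^*(m))$ is positive definite for every $n\ge 1$.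
   Context: For a real tensor $\mathcal{A}=(a_{i_1\cdots i_m})$ of order $m$ and dimension $n$ (indices in $\{1,\dots,n\}$) and $\mathbf{x}\in\mathbb{R}^n$, put $\mathcal{A}\mathbf{x}^m=\sum_{i_1,\dots,i_m=1}^n a_{i_1\cdots i_m}x_{i_1}\cdots x_{i_m}$, and let $\mathcal{A}\mathbf{x}^{m-1}\in\mathbb{R}^n$ be the vector with $i$-th entry $\sum_{i_2,\dots,i_m=1}^n a_{i i_2\cdots i_m}x_{i_2}\cdots x_{i_m}$. The tensor $\mathcal{A}$ is positive definite if $\mathcal{A}\mathbf{x}^m>0$ for all nonzero $\mathbf{x}\in\mathbb{R}^n$, and positive semi-definite if $\mathcal{A}\mathbf{x}^m\ge 0$ for all $\mathbf{x}\in\mathbb{R}^n$. A real number $\lambda$ is an H-eigenvalue of $\mathcal{A}$ if there is a nonzero $\mathbf{x}\in\mathbb{R}^n$ with $\mathcal{A}\mathbf{x}^{m-1}=\lambda\,\mathbf{x}^{[m-1]}$, where $\mathbf{x}^{[m-1]}=(x_1^{m-1},\dots,x_n^{m-1})^\top$. For a symmetric tensor of even order $m$, the smallest H-eigenvalue exists and equals $\min\{\mathcal{A}\mathbf{x}^m:\sum_{i}|x_i|^m=1\}$. For positive integers $n,m$, $\mathcal{M}(n,m)$ is the tensor of order $m$ and dimension $n$ with entries $\min\{i_1,\dots,i_m\}$, and $\mathcal{N}(n,m)$ is the tensor of order $m$ and dimension $n$ with entry $0$ if $i_1=\cdots=i_m$ and $1$ otherwise. For even $m$, a real number $\alpha$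 is an MO value (for $m$) if $\mathcal{M}(n,m)-\alpha\,\mathcal{N}(n,m)$ is positive semi-definite for every $n\ge 1$; the MO set $\Omega(m)$ is the set of all MO values, and the Sup-MO value is $\alpha^*(m)=\sup\Omega(m)$. This supremum is finite and attained, so $\alpha^*(m)=\max\Omega(m)$. *)

theory Defs
  imports "HOL-Analysis.Analysis"
begin

text \<open>
  Vectors of \<open>\<real>\<^sup>n\<close> are functions \<open>x :: nat \<Rightarrow> real\<close> of which only the entries \<open>x 1, \<dots>, x n\<close> matter.
  A tensor is given by its entry function on index lists \<open>[i\<^sub>1, \<dots>, i\<^sub>m]\<close>; the dimension \<open>n\<close> and
  the order \<open>m\<close> are arguments of the notions below, which only read the entries at lists of
  length \<open>m\<close> with elements in \<open>{1..n}\<close>. Every notion involving \<open>m\<close> is meant for \<open>m \<ge> 1\<close>.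
\<close>

type_synonym tensor = "nat list \<Rightarrow> real"

definition index_lists :: "nat \<Rightarrow> nat \<Rightarrow> nat list set" where
  "index_lists n m = {is. length is = m \<and> set is \<subseteq> {1..n}}"

definition nonzero_vec :: "nat \<Rightarrow> (nat \<Rightarrow> real) \<Rightarrow> bool" where
  "nonzero_vec n x \<longleftrightarrow> (\<exists>i\<in>{1..n}. x i \<noteq> 0)"

text \<open>The scalar \<open>A x\<^sup>m\<close>, and the \<open>i\<close>-th entry of the vector \<open>A x\<^bsup>m-1\<^esup>\<close>.\<close>

definition tensor_form :: "nat \<Rightarrow> nat \<Rightarrow> tensor \<Rightarrow> (nat \<Rightarrow> real) \<Rightarrow> real" where
  "tensor_form n m A x = (\<Sum>is\<in>index_lists n m. A is * prod_list (map x is))"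

definition tensor_map :: "nat \<Rightarrow> nat \<Rightarrow> tensor \<Rightarrow> (nat \<Rightarrow> real) \<Rightarrow> nat \<Rightarrow> real" where
  "tensor_map n m A x i = (\<Sum>is\<in>index_lists n (m - 1). A (i # is) * prod_list (map x is))"

definition tensor_pos_def :: "nat \<Rightarrow> nat \<Rightarrow> tensor \<Rightarrow> bool" where
  "tensor_pos_def n m A \<longleftrightarrow> (\<forall>x. nonzero_vec n x \<longrightarrow> tensor_form n m A x > 0)"

definition tensor_pos_semidef :: "nat \<Rightarrow> nat \<Rightarrow> tensor \<Rightarrow> bool" where
  "tensor_pos_semidef n m A \<longleftrightarrow> (\<forall>x. tensor_form n m A x \<ge> 0)"

definition H_eigenvalue :: "nat \<Rightarrow> nat \<Rightarrow> tensor \<Rightarrow> real \<Rightarrow> bool" where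
  "H_eigenvalue n m A l \<longleftrightarrow>
     (\<exists>x. nonzero_vec n x \<and> (\<forall>i\<in>{1..n}. tensor_map n m A x i = l * x i ^ (m - 1)))"

text \<open>For a symmetric tensor of even order and dimension \<open>n \<ge> 1\<close> the minimum exists.\<close>

definition min_H_eigenvalue :: "nat \<Rightarrow> nat \<Rightarrow> tensor \<Rightarrow> real" where
  "min_H_eigenvalue n m A = (LEAST l. H_eigenvalue n m A l)"

text \<open>The entry formulas of \<open>M(n,m)\<close> and \<open>N(n,m)\<close> do not depend on \<open>n\<close> and \<open>m\<close>.\<close>

definition M_tensor :: tensor where
  "M_tensor is = real (Min (set is))"

definition N_tensor :: tensor where
  "N_tensor is = (if \<forall>i\<in>set is. \<forall>j\<in>set is. i = j then 0 else 1)"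

definition MN_tensor :: "real \<Rightarrow> tensor" where
  "MN_tensor \<alpha> is = M_tensor is - \<alpha> * N_tensor is"

definition MO_set :: "nat \<Rightarrow> real set" where
  "MO_set m = {\<alpha>. \<forall>n\<ge>1. tensor_pos_semidef n m (MN_tensor \<alpha>)}"

text \<open>For even \<open>m \<ge> 2\<close> this supremum is finite and attained.\<close>

definition sup_MO_value :: "nat \<Rightarrow> real" where
  "sup_MO_value m = Sup (MO_set m)"

definition sup_MO_tensor :: "nat \<Rightarrow> tensor" where
  "sup_MO_tensor m = MN_tensor (sup_MO_value m)"

lemma sup_MO_tensor_diag:
  assumes "m \<ge> 1"
  shows "sup_MO_tensor m (replicate m i) = real i"
  using assms by (simp add: sup_MO_tensor_def MN_tensor_def M_tensor_def N_tensor_def)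

lemma sup_MO_tensor_offdiag:
  assumes "i \<in> set is" "j \<in> set is" "i \<noteq> j"
  shows "sup_MO_tensor m is = real (Min (set is)) - sup_MO_value m"
  using assms by (auto simp: sup_MO_tensor_def MN_tensor_def M_tensor_def N_tensor_def)

end

theory Submission
  imports Defs
begin

text \<open>
  With \<open>s\<^sub>k = x\<^sub>k + \<dots> + x\<^sub>n\<close>, the form of \<open>M(n,m) - \<alpha> N(n,m)\<close> is
  \<open>\<Sum>\<^sub>k s\<^sub>k\<^sup>m - \<alpha> (s\<^sub>1\<^sup>m - \<Sum>\<^sub>i x\<^sub>i\<^sup>m)\<close>. Splitting the last nonzero coordinate \<open>u\<close> of \<open>x\<close> into
  \<open>u - t\<close> and \<open>t\<close>, with \<open>t\<close> a small multiple of \<open>u\<close>, lowers the form minus \<open>\<lambda> \<Sum>\<^sub>i x\<^sub>i\<^sup>m\<close> whenever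
  \<open>\<lambda> < \<alpha>\<close>. For \<open>\<lambda> = 0\<close> this excludes nontrivial zeros of a form that is semi-definite in all
  dimensions, and for the smallest H-eigenvalue \<open>\<lambda>\<close>, which is at most \<open>1 < 1 + 2\<^bsup>-m\<^esup> \<le> \<alpha>\<^sup>*\<close>, it
  gives strict decrease. If all these eigenvalues were at least \<open>L > 0\<close>, then \<open>\<alpha>\<^sup>*\<close> could be
  increased: either \<open>\<Sum>\<^sub>i x\<^sub>i\<^sup>m\<close> is comparable to \<open>s\<^sub>1\<^sup>m\<close>, and \<open>L\<close> leaves room, or all
  coordinates are small against \<open>s\<^sub>1\<close>, so that many tails \<open>s\<^sub>k\<close> exceed \<open>s\<^sub>1/2\<close> and \<open>\<Sum>\<^sub>k s\<^sub>k\<^sup>m\<close> is large.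
\<close>

subsection \<open>The form as a function of the tail sums\<close>

definition power_sum :: "nat \<Rightarrow> nat \<Rightarrow> (nat \<Rightarrow> real) \<Rightarrow> real" where
  "power_sum n m x = (\<Sum>i=1..n. x i ^ m)"

definition tail_power_sum :: "nat \<Rightarrow> nat \<Rightarrow> (nat \<Rightarrow> real) \<Rightarrow> real" where
  "tail_power_sum n m x = (\<Sum>k=1..n. (\<Sum>j=k..n. x j) ^ m)"

lemma index_lists_0: "index_lists n 0 = {[]}"
  by (auto simp: index_lists_def)

lemma index_lists_Suc: "index_lists n (Suc m) = (\<lambda>(i, is). i # is) ` ({1..n} \<times> index_lists n m)"
  by (force simp: index_lists_def image_iff length_Suc_conv)

lemma sum_index_lists_Suc:
  "(\<Sum>is\<in>index_lists n (Suc m). g is) = (\<Sum>i=1..n. \<Sum>is\<in>index_lists n m. g (i # is))"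
proof -
  have "inj_on (\<lambda>(i, is). i # is) ({1..n} \<times> index_lists n m)"
    by (auto simp: inj_on_def)
  then show ?thesis
    by (simp add: index_lists_Suc sum.reindex sum.cartesian_product case_prod_unfold)
qed

text \<open>Expanding the power by distributivity yields one product for each index list. Whatever
  is written as a product over the entries of a list can thus be summed in closed form.\<close>

lemma sum_prod_list_index_lists:
  fixes f :: "nat \<Rightarrow> real"
  shows "(\<Sum>is\<in>index_lists n m. prod_list (map f is)) = (\<Sum>i=1..n. f i) ^ m"
  by (induction m)
    (simp_all add: index_lists_0 sum_index_lists_Suc flip: sum_distrib_left sum_distrib_right)

lemma prod_list_map_mult:
  fixes f g :: "'a \<Rightarrow> 'b :: comm_monoid_mult"
  shows "prod_list (map f xs) * prod_list (map g xs) = prod_list (map (\<lambda>x. f x * g x) xs)"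
  by (induction xs) (simp_all add: ac_simps)

lemma prod_list_of_bool: "prod_list (map (\<lambda>j. of_bool (P j)) xs) = (of_bool (\<forall>j\<in>set xs. P j) :: real)"
  by (induction xs) auto

text \<open>The minimum of positive integers counts the \<open>k\<close> \<ge> 1 that lie below all
  of them. Each condition is a product of indicators over the list, the shape that
  \<open>sum_prod_list_index_lists\<close> sums.\<close>

lemma M_tensor_eq_sum:
  assumes "i \<in> {1..n}"
  shows "M_tensor (i # is) = (\<Sum>k=1..i. prod_list (map (\<lambda>j. of_bool (k \<le> j)) is))"
proof -
  let ?\<mu> = "Min (set (i # is))"
  have "{k \<in> {1..i}. \<forall>j\<in>set is. k \<le> j} = {1..?\<mu>}"
    by (auto simp: Min_ge_iff simp del: Min_insert)
  then have "(\<Sum>k=1..i. of_bool (\<forall>j\<in>set is. k \<le> j)) = real ?\<mu>"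
    by (simp add: of_bool_def sum.If_cases Int_def del: Min_insert)
  then show ?thesis
    by (simp add: M_tensor_def prod_list_of_bool)
qed

lemma N_tensor_eq: "N_tensor (i # is) = 1 - prod_list (map (\<lambda>j. of_bool (j = i)) is)"
  by (auto simp: N_tensor_def prod_list_of_bool)

lemma tensor_map_MN:
  assumes i: "i \<in> {1..n}"
  shows "tensor_map n (Suc p) (MN_tensor \<alpha>) x i =
    (\<Sum>k=1..i. (\<Sum>j=k..n. x j) ^ p) - \<alpha> * ((\<Sum>j=1..n. x j) ^ p - x i ^ p)"
proof -
  let ?L = "index_lists n p"
  have "tensor_map n (Suc p) (MN_tensor \<alpha>) x i =
    (\<Sum>is\<in>?L. (\<Sum>k=1..i. prod_list (map (\<lambda>j. of_bool (k \<le> j) * x j) is))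
      - \<alpha> * (prod_list (map x is) - prod_list (map (\<lambda>j. of_bool (j = i) * x j) is)))"
    unfolding tensor_map_def
    by (rule sum.cong)
      (simp_all add: MN_tensor_def M_tensor_eq_sum[OF i] N_tensor_eq left_diff_distrib
        sum_distrib_left sum_distrib_right algebra_simps flip: prod_list_map_mult)
  \<comment> \<open>After exchanging the sums over \<open>k\<close> and over lists, every inner sum
    is the expansion of a \<open>p\<close>-th power.\<close>
  also have "\<dots> = (\<Sum>k=1..i. (\<Sum>j=1..n. of_bool (k \<le> j) * x j) ^ p)
      - \<alpha> * ((\<Sum>j=1..n. x j) ^ p - (\<Sum>j=1..n. of_bool (j = i) * x j) ^ p)"
    unfolding sum_subtractf
    by (subst sum.swap) (simp add: sum_prod_list_index_lists sum_subtractf flip: sum_distrib_left)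
  also have "(\<Sum>j=1..n. of_bool (j = i) * x j) = x i"
    using i by (simp add: Int_def cong: conj_cong)
  also have "(\<Sum>k=1..i. (\<Sum>j=1..n. of_bool (k \<le> j) * x j) ^ p) = (\<Sum>k=1..i. (\<Sum>j=k..n. x j) ^ p)"
  proof (rule sum.cong)
    fix k assume "k \<in> {1..i}"
    then have "{1..n} \<inter> {j. k \<le> j} = {k..n}" by auto
    then show "(\<Sum>j=1..n. of_bool (k \<le> j) * x j) ^ p = (\<Sum>j=k..n. x j) ^ p"
      by simp
  qed simp
  finally show ?thesis .
qed

lemma tensor_form_eq_sum_tensor_map:
  assumes "m \<ge> 1"
  shows "tensor_form n m A x = (\<Sum>i=1..n. x i * tensor_map n m A x i)"
proof -
  obtain p where m: "m = Suc p" using assms by (cases m) auto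
  show ?thesis
    by (simp add: m tensor_form_def tensor_map_def sum_index_lists_Suc sum_distrib_left ac_simps)
qed

text \<open>The form is the sum of \<open>x i\<close> times the \<open>i\<close>-th entry of
  \<open>tensor_map\<close>. Exchanging the sums over \<open>i\<close> and \<open>k\<close> \<le>
  \<open>i\<close> collects, for each \<open>k\<close>, one more factor equal to the tail sum from
  \<open>k\<close>.\<close>

lemma tensor_form_MN:
  assumes "m \<ge> 1"
  shows "tensor_form n m (MN_tensor \<alpha>) x =
    tail_power_sum n m x - \<alpha> * ((\<Sum>j=1..n. x j) ^ m - power_sum n m x)"
proof -
  obtain p where m: "m = Suc p" using assms by (cases m) auto
  have "(\<Sum>i=1..n. x i * (\<Sum>k=1..i. (\<Sum>j=k..n. x j) ^ p)) =
      (\<Sum>i=1..n. \<Sum>k=1..n. of_bool (k \<le> i) * x i * (\<Sum>j=k..n. x j) ^ p)"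
  proof (rule sum.cong)
    fix i assume "i \<in> {1..n}"
    then have "{1..n} \<inter> {k. k \<le> i} = {1..i}" by auto
    then show "x i * (\<Sum>k=1..i. (\<Sum>j=k..n. x j) ^ p) =
        (\<Sum>k=1..n. of_bool (k \<le> i) * x i * (\<Sum>j=k..n. x j) ^ p)"
      by (simp add: sum_distrib_left mult.assoc)
  qed simp
  also have "\<dots> = (\<Sum>k=1..n. (\<Sum>i=1..n. of_bool (k \<le> i) * x i) * (\<Sum>j=k..n. x j) ^ p)"
    by (subst sum.swap) (simp add: sum_distrib_right del: sum_of_bool_mult_eq sum_mult_of_bool_eq)
  also have "\<dots> = tail_power_sum n m x"
    unfolding tail_power_sum_def
  proof (rule sum.cong)
    fix k assume "k \<in> {1..n}"
    then have "{1..n} \<inter> {j. k \<le> j} = {k..n}" by auto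
    then show "(\<Sum>i=1..n. of_bool (k \<le> i) * x i) * (\<Sum>j=k..n. x j) ^ p = (\<Sum>j=k..n. x j) ^ m"
      by (simp add: m)
  qed simp
  finally have *: "(\<Sum>i=1..n. x i * (\<Sum>k=1..i. (\<Sum>j=k..n. x j) ^ p)) = tail_power_sum n m x" .
  have "tensor_form n m (MN_tensor \<alpha>) x =
      (\<Sum>i=1..n. x i * (\<Sum>k=1..i. (\<Sum>j=k..n. x j) ^ p))
      - \<alpha> * ((\<Sum>i=1..n. x i * (\<Sum>j=1..n. x j) ^ p) - (\<Sum>i=1..n. x i * x i ^ p))"
    using assms
    by (simp add: tensor_form_eq_sum_tensor_map m tensor_map_MN algebra_simps sum_subtractf
        sum.distrib sum_distrib_left)
  then show ?thesis
    unfolding * by (simp add: m power_sum_def flip: sum_distrib_right)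
qed

lemma power_sum_nonneg: "even m \<Longrightarrow> power_sum n m x \<ge> 0"
  unfolding power_sum_def by (intro sum_nonneg) auto

lemma power_sum_pos:
  assumes "even m" "nonzero_vec n x"
  shows "power_sum n m x > 0"
proof -
  obtain i where "i \<in> {1..n}" "x i \<noteq> 0" using assms(2) by (auto simp: nonzero_vec_def)
  then show ?thesis
    unfolding power_sum_def using assms(1) by (intro sum_pos2[of _ i]) (auto simp: zero_less_power_eq)
qed

subsection \<open>Minimising the form on the unit sphere of the \<open>m\<close>-norm\<close>

lemma DERIV_shift_power:
  "((\<lambda>t. (a + c * t) ^ m) has_real_derivative real m * a ^ (m - 1) * c) (at (0::real))"
  by (auto intro!: derivative_eq_intros)

lemma sum_fun_upd_add:
  fixes x :: "nat \<Rightarrow> real"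
  assumes "i \<le> n"
  shows "(\<Sum>j=k..n. (x(i := x i + t)) j) = (\<Sum>j=k..n. x j) + of_bool (k \<le> i) * t"
proof -
  have "(\<Sum>j=k..n. (x(i := x i + t)) j) = (\<Sum>j=k..n. x j + (if j = i then t else 0))"
    by (rule sum.cong) auto
  then show ?thesis using assms by (simp add: sum.distrib)
qed

lemma DERIV_power_sum:
  assumes i: "i \<in> {1..n}"
  shows "((\<lambda>t. power_sum n m (x(i := x i + t))) has_real_derivative real m * x i ^ (m - 1)) (at 0)"
proof -
  have pow: "power_sum n m (x(i := x i + t)) = (\<Sum>j=1..n. (x j + of_bool (j = i) * t) ^ m)" for t
    unfolding power_sum_def by (rule sum.cong) auto
  have "(\<Sum>j=1..n. real m * x j ^ (m - 1) * of_bool (j = i)) = real m * x i ^ (m - 1)"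
    using i by (simp add: of_bool_def if_distrib sum.If_cases cong: if_cong)
  moreover have "((\<lambda>t. power_sum n m (x(i := x i + t))) has_real_derivative
     (\<Sum>j=1..n. real m * x j ^ (m - 1) * of_bool (j = i))) (at 0)"
    unfolding pow by (intro DERIV_sum DERIV_shift_power)
  ultimately show ?thesis by simp
qed

text \<open>The gradient of \<open>A x^m\<close> is \<open>m A x^(m-1)\<close> for a symmetric
  tensor. Here it is read off from the tail sums: moving coordinate \<open>i\<close> shifts exactly
  the tails with \<open>k\<close> \<le> \<open>i\<close>.\<close>

lemma DERIV_tensor_form_MN:
  assumes m: "m \<ge> 1" and i: "i \<in> {1..n}"
  shows "((\<lambda>t. tensor_form n m (MN_tensor \<alpha>) (x(i := x i + t)))
    has_real_derivative real m * tensor_map n m (MN_tensor \<alpha>) x i) (at 0)"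
proof -
  obtain p where p: "m = Suc p" using m by (cases m) auto
  have "i \<le> n" using i by simp
  note tail = sum_fun_upd_add[OF this]
  have "{1..n} \<inter> {k. k \<le> i} = {1..i}" using i by auto
  then have *: "(\<Sum>k=1..n. real m * (\<Sum>j=k..n. x j) ^ (m - 1) * of_bool (k \<le> i)) =
      real m * (\<Sum>k=1..i. (\<Sum>j=k..n. x j) ^ (m - 1))"
    by (simp add: of_bool_def if_distrib sum.If_cases sum_distrib_left cong: if_cong)
  have "((\<lambda>t. tensor_form n m (MN_tensor \<alpha>) (x(i := x i + t))) has_real_derivative
     (\<Sum>k=1..n. real m * (\<Sum>j=k..n. x j) ^ (m - 1) * of_bool (k \<le> i))
     - \<alpha> * (real m * (\<Sum>j=1..n. x j) ^ (m - 1) * of_bool (1 \<le> i) - real m * x i ^ (m - 1))) (at 0)"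
    unfolding tensor_form_MN[OF m] tail_power_sum_def tail
    by (intro DERIV_diff DERIV_cmult DERIV_sum DERIV_shift_power DERIV_power_sum i)
  then show ?thesis
    using i unfolding * by (simp add: p tensor_map_MN algebra_simps)
qed

lemma tensor_form_MN_cong:
  assumes "\<And>i. i \<in> {1..n} \<Longrightarrow> x i = y i" "m \<ge> 1"
  shows "tensor_form n m (MN_tensor \<alpha>) x = tensor_form n m (MN_tensor \<alpha>) y"
proof -
  have "(\<Sum>j=k..n. x j) = (\<Sum>j=k..n. y j)" if "k \<ge> 1" for k
    using assms(1) that by (intro sum.cong) auto
  moreover have "power_sum n m x = power_sum n m y"
    unfolding power_sum_def using assms(1) by (intro sum.cong) auto
  ultimately show ?thesis
    using assms(2) by (simp add: tensor_form_MN tail_power_sum_def)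
qed

lemma tensor_form_MN_scale:
  "m \<ge> 1 \<Longrightarrow> tensor_form n m (MN_tensor \<alpha>) (\<lambda>i. c * x i) = c ^ m * tensor_form n m (MN_tensor \<alpha>) x"
  by (simp add: tensor_form_MN tail_power_sum_def power_sum_def power_mult_distrib algebra_simps
      flip: sum_distrib_left)

lemma power_sum_scale: "power_sum n m (\<lambda>i. c * x i) = c ^ m * power_sum n m x"
  by (simp add: power_sum_def power_mult_distrib sum_distrib_left)

text \<open>By homogeneity the minimum \<open>l\<close> on the unit sphere of the
  \<open>m\<close>-norm gives an inequality for all vectors. In this form \<open>x\<close> is an
  unconstrained minimiser of the form minus \<open>l\<close> times the power sum, so no Lagrange
  multiplier is needed later.\<close>

lemma tensor_form_minimiser:
  assumes n: "n \<ge> 1" and m: "m \<ge> 1" "even m"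
  obtains x l where "nonzero_vec n x" "tensor_form n m (MN_tensor \<alpha>) x = l * power_sum n m x"
    "\<And>y. tensor_form n m (MN_tensor \<alpha>) y \<ge> l * power_sum n m y"
proof -
  let ?F = "tensor_form n m (MN_tensor \<alpha>)"
  \<comment> \<open>Entries outside \<open>{1..n}\<close> are pinned to 0, so that the box is a
    product of compact sets in the space of all functions.\<close>
  define B where "B = (\<lambda>i. if i \<in> {1..n} then {-1..1::real} else {0})"
  define S where "S = PiE UNIV B \<inter> {x. power_sum n m x = 1}"
  have "compactin (product_topology (\<lambda>_. euclideanreal) UNIV) (PiE UNIV B)"
    by (auto simp: compactin_PiE B_def)
  then have "compact (PiE UNIV B)"
    by (simp add: euclidean_product_topology)
  moreover have "closed {x. power_sum n m x = 1}"
    unfolding power_sum_def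
    by (intro closed_Collect_eq continuous_intros continuous_on_product_coordinates)
  ultimately have "compact S" unfolding S_def by (rule compact_Int_closed)
  moreover have "S \<noteq> {}"
  proof -
    have "(\<lambda>i. of_bool (i = 1)) \<in> S"
      using n m by (auto simp: S_def B_def power_sum_def of_bool_def power_0_left if_distribR
          if_distrib[of "\<lambda>z. z ^ m"] sum.If_cases cong: if_cong)
    then show ?thesis by auto
  qed
  moreover have "continuous_on S ?F"
    unfolding tensor_form_MN[OF m(1)] tail_power_sum_def power_sum_def
    by (intro continuous_intros continuous_on_subset[OF continuous_on_product_coordinates]) auto
  ultimately obtain x where x: "x \<in> S" "\<And>y. y \<in> S \<Longrightarrow> ?F x \<le> ?F y"
    using continuous_attains_inf[of S ?F] by auto
  have ge: "?F y \<ge> ?F x * power_sum n m y" for y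
  proof (cases "nonzero_vec n y")
    case False
    then have "\<And>i. i \<in> {1..n} \<Longrightarrow> y i = 0" by (auto simp: nonzero_vec_def)
    then show ?thesis using m by (simp add: tensor_form_MN power_sum_def tail_power_sum_def power_0_left)
  next
    case True
    define P where "P = power_sum n m y"
    have P: "P > 0" unfolding P_def using power_sum_pos m True by blast
    define c where "c = 1 / root m P"
    have c: "c ^ m = 1 / P" "c > 0"
      using P m by (simp_all add: c_def power_divide real_root_pow_pos2)
    \<comment> \<open>Normalising \<open>y\<close> is not enough for membership in \<open>S\<close>:
      the irrelevant entries must be cleared too.\<close>
    define z where "z = (\<lambda>i. if i \<in> {1..n} then c * y i else 0)"
    have Pz: "power_sum n m z = 1"
    proof -
      have "power_sum n m z = power_sum n m (\<lambda>i. c * y i)"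
        by (simp add: power_sum_def z_def)
      then show ?thesis using P c by (simp add: power_sum_scale flip: P_def)
    qed
    have "\<bar>z i\<bar> \<le> 1" if "i \<in> {1..n}" for i
    proof -
      have "z i ^ m \<le> power_sum n m z"
        unfolding power_sum_def using that m by (intro member_le_sum) auto
      then show ?thesis using Pz m by (simp add: power_le_one_iff flip: power_even_abs[of m "z i"])
    qed
    then have "z \<in> S" using Pz by (auto simp: S_def B_def z_def abs_le_iff)
    then have "?F x \<le> ?F z" by (rule x)
    also have "?F z = ?F (\<lambda>i. c * y i)"
      using m by (intro tensor_form_MN_cong) (auto simp: z_def)
    also have "\<dots> = ?F y / P" using m c by (simp add: tensor_form_MN_scale)
    finally show ?thesis using P by (simp add: field_simps P_def)
  qed
  have 1: "power_sum n m x = 1" using x by (simp add: S_def)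
  have "nonzero_vec n x"
  proof (rule ccontr)
    assume "\<not> nonzero_vec n x"
    then have "power_sum n m x = 0" using m by (simp add: nonzero_vec_def power_sum_def power_0_left)
    with 1 show False by simp
  qed
  then show ?thesis using that[of x "?F x"] 1 ge by simp
qed

text \<open>At a minimiser the partial derivatives of the form minus \<open>k\<close> times the
  power sum vanish, which is the eigenvalue equation. Conversely, pairing the equation of any
  H-eigenvalue \<open>h\<close> with its eigenvector gives form = \<open>h\<close> times power sum,
  hence \<open>k\<close> \<le> \<open>h\<close>.\<close>

lemma min_H_eigenvalue_MN:
  fixes \<alpha> :: real
  assumes n: "n \<ge> 1" and m: "m \<ge> 1" "even m"
  defines "l \<equiv> min_H_eigenvalue n m (MN_tensor \<alpha>)"
  shows "l * power_sum n m y \<le> tensor_form n m (MN_tensor \<alpha>) y"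
    and "\<exists>x. nonzero_vec n x \<and> tensor_form n m (MN_tensor \<alpha>) x = l * power_sum n m x"
proof -
  let ?F = "tensor_form n m (MN_tensor \<alpha>)"
  obtain x k where x: "nonzero_vec n x" "?F x = k * power_sum n m x"
    "\<And>y. ?F y \<ge> k * power_sum n m y"
    using tensor_form_minimiser[OF n m] by blast
  have "tensor_map n m (MN_tensor \<alpha>) x i = k * x i ^ (m - 1)" if i: "i \<in> {1..n}" for i
  proof -
    let ?y = "\<lambda>t. x(i := x i + t)"
    have "((\<lambda>t. ?F (?y t) - k * power_sum n m (?y t)) has_real_derivative
        real m * tensor_map n m (MN_tensor \<alpha>) x i - k * (real m * x i ^ (m - 1))) (at 0)"
      by (intro DERIV_diff DERIV_cmult DERIV_tensor_form_MN DERIV_power_sum m i)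
    then have "real m * tensor_map n m (MN_tensor \<alpha>) x i - k * (real m * x i ^ (m - 1)) = 0"
      by (rule DERIV_local_min[where d = 1]) (use x in auto)
    then show ?thesis using m by (simp add: algebra_simps)
  qed
  then have "H_eigenvalue n m (MN_tensor \<alpha>) k"
    using x(1) by (auto simp: H_eigenvalue_def)
  moreover have "k \<le> h" if h: "H_eigenvalue n m (MN_tensor \<alpha>) h" for h
  proof -
    obtain z where z: "nonzero_vec n z"
      "\<And>i. i \<in> {1..n} \<Longrightarrow> tensor_map n m (MN_tensor \<alpha>) z i = h * z i ^ (m - 1)"
      using h unfolding H_eigenvalue_def by blast
    obtain p where p: "m = Suc p" using m by (cases m) auto
    have "?F z = h * power_sum n m z"
      using m z(2) by (simp add: tensor_form_eq_sum_tensor_map power_sum_def sum_distrib_left p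
          algebra_simps)
    then show ?thesis using x(3)[of z] power_sum_pos[OF m(2) z(1)] by simp
  qed
  ultimately have "l = k"
    unfolding l_def min_H_eigenvalue_def by (rule Least_equality)
  then show "l * power_sum n m y \<le> ?F y" "\<exists>x. nonzero_vec n x \<and> ?F x = l * power_sum n m x"
    using x by auto
qed

subsection \<open>Lowering the form by adding a coordinate\<close>

text \<open>With \<open>c\<close> = \<alpha> - \<open>l\<close>, this expression is the change
  caused by splitting \<open>u\<close> into \<open>u - t\<close> and \<open>t\<close>. For
  \<open>t\<close> = \<open>r * u\<close> the gain from \<open>(1 - r) ^ m\<close> is of first order
  in \<open>r\<close>, while the cost \<open>r ^ m\<close> is at most of second order.\<close>

lemma split_coordinate:
  fixes c u :: real
  assumes "c > 0" "u \<noteq> 0" "m \<ge> 2" "even m"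
  obtains t where "t ^ m + c * ((u - t) ^ m + t ^ m - u ^ m) < 0"
proof -
  \<comment> \<open>Half of the threshold \<open>c / (1 + c)\<close> below which
    \<open>r * (1 + c) < c\<close>.\<close>
  define r where "r = c / (2 * (1 + c))"
  have r: "0 < r" "r < 1" "r * (1 + c) < c" using assms(1) by (auto simp: r_def field_simps add_pos_pos)
  have "r ^ m * (1 + c) \<le> r ^ 2 * (1 + c)"
    using assms r by (intro mult_right_mono power_decreasing) auto
  also have "\<dots> = r * (r * (1 + c))" by (simp add: power2_eq_square)
  also have "\<dots> < r * c" using r by simp
  finally have 1: "r ^ m * (1 + c) < r * c" .
  have "(1 - r) ^ m \<le> (1 - r) ^ 1"
    using assms r by (intro power_decreasing) auto
  then have 2: "c * ((1 - r) ^ m - 1) \<le> c * (- r)"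
    using assms by (intro mult_left_mono) auto
  have "u - r * u = (1 - r) * u" by (simp add: algebra_simps)
  then have "(r * u) ^ m + c * ((u - r * u) ^ m + (r * u) ^ m - u ^ m) =
      u ^ m * (r ^ m * (1 + c) + c * ((1 - r) ^ m - 1))"
    by (simp only: power_mult_distrib) (simp add: algebra_simps)
  also have "\<dots> < 0"
    using 1 2 assms by (intro mult_pos_neg) (auto simp: zero_less_power_eq algebra_simps)
  finally show ?thesis by (rule that)
qed

text \<open>The two pieces add up to the old coordinate, so the old tails are unchanged and the only
  new tail is \<open>t\<close>.\<close>

lemma tail_power_sum_split:
  assumes "n \<ge> 1"
  shows "tail_power_sum (Suc n) m (x(n := x n - t, Suc n := t)) = tail_power_sum n m x + t ^ m"
proof -
  have "(\<Sum>j=k..Suc n. (x(n := x n - t, Suc n := t)) j) = (\<Sum>j=k..n. x j)" if "k \<in> {1..n}" for k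
  proof -
    have "{k..Suc n} = insert (Suc n) (insert n {k..<n})" "{k..n} = insert n {k..<n}"
      using that by auto
    then show ?thesis by simp
  qed
  then show ?thesis by (simp add: tail_power_sum_def)
qed

lemma sum_split:
  fixes x :: "nat \<Rightarrow> real"
  assumes "n \<ge> 1"
  shows "(\<Sum>j=1..Suc n. (x(n := x n - t, Suc n := t)) j) = (\<Sum>j=1..n. x j)"
proof -
  have "{1..Suc n} = insert (Suc n) (insert n {1..<n})" "{1..n} = insert n {1..<n}"
    using assms by auto
  then show ?thesis by simp
qed

lemma power_sum_split:
  assumes "n \<ge> 1"
  shows "power_sum (Suc n) m (x(n := x n - t, Suc n := t)) =
    power_sum n m x + ((x n - t) ^ m + t ^ m - x n ^ m)"
proof -
  have "{1..Suc n} = insert (Suc n) (insert n {1..<n})" "{1..n} = insert n {1..<n}"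
    using assms by auto
  then show ?thesis by (simp add: power_sum_def)
qed

lemma tail_power_sum_Suc_zero:
  assumes "x (Suc n) = 0" "m \<ge> 1"
  shows "tail_power_sum (Suc n) m x = tail_power_sum n m x"
  using assms by (simp add: tail_power_sum_def power_0_left)

lemma tensor_form_MN_Suc_zero:
  assumes "x (Suc n) = 0" "m \<ge> 1"
  shows "tensor_form (Suc n) m (MN_tensor \<alpha>) x = tensor_form n m (MN_tensor \<alpha>) x"
    "power_sum (Suc n) m x = power_sum n m x"
  using assms
  by (simp_all add: tensor_form_MN power_sum_def tail_power_sum_Suc_zero power_0_left)

lemma tensor_form_descent:
  assumes "nonzero_vec n x" "l < \<alpha>" "m \<ge> 2" "even m"
  shows "\<exists>y. tensor_form (Suc n) m (MN_tensor \<alpha>) y - l * power_sum (Suc n) m y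
    < tensor_form n m (MN_tensor \<alpha>) x - l * power_sum n m x"
  using assms(1)
proof (induction n)
  case 0
  then show ?case by (simp add: nonzero_vec_def)
next
  case (Suc n)
  have m: "m \<ge> 1" using assms by simp
  show ?case
  proof (cases "x (Suc n) = 0")
    case True
    then have "nonzero_vec n x"
      using Suc.prems by (auto simp: nonzero_vec_def atLeastAtMostSuc_conv)
    then obtain y where y: "tensor_form (Suc n) m (MN_tensor \<alpha>) y - l * power_sum (Suc n) m y
        < tensor_form n m (MN_tensor \<alpha>) x - l * power_sum n m x"
      using Suc.IH by blast
    \<comment> \<open>Padding with a zero carries the vector found one dimension lower up to the
      required dimension.\<close>
    let ?z = "y(Suc (Suc n) := 0)"
    have "tensor_form (Suc (Suc n)) m (MN_tensor \<alpha>) ?z = tensor_form (Suc n) m (MN_tensor \<alpha>) ?z"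
      using m by (intro tensor_form_MN_Suc_zero) auto
    also have "\<dots> = tensor_form (Suc n) m (MN_tensor \<alpha>) y"
      using m by (intro tensor_form_MN_cong) auto
    finally have "tensor_form (Suc (Suc n)) m (MN_tensor \<alpha>) ?z = tensor_form (Suc n) m (MN_tensor \<alpha>) y" .
    moreover have "power_sum (Suc (Suc n)) m ?z = power_sum (Suc n) m y"
      using m by (simp add: power_sum_def power_0_left)
    ultimately show ?thesis
      using y tensor_form_MN_Suc_zero[of x n m, OF True m] by (intro exI[of _ ?z]) (simp del: fun_upd_apply)
  next
    case False
    then obtain t where t: "t ^ m + (\<alpha> - l) * ((x (Suc n) - t) ^ m + t ^ m - x (Suc n) ^ m) < 0"
      using split_coordinate[of "\<alpha> - l" "x (Suc n)" m] assms by auto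
    define y where "y = x(Suc n := x (Suc n) - t, Suc (Suc n) := t)"
    have "tensor_form (Suc (Suc n)) m (MN_tensor \<alpha>) y - l * power_sum (Suc (Suc n)) m y =
      tensor_form (Suc n) m (MN_tensor \<alpha>) x - l * power_sum (Suc n) m x
        + (t ^ m + (\<alpha> - l) * ((x (Suc n) - t) ^ m + t ^ m - x (Suc n) ^ m))"
      unfolding tensor_form_MN[OF m] y_def
      by (subst tail_power_sum_split sum_split power_sum_split, simp)+ (simp add: algebra_simps)
    then show ?thesis using t by (intro exI[of _ y]) simp
  qed
qed

subsection \<open>The Sup-MO value\<close>

lemma MO_set_iff:
  assumes "m \<ge> 1"
  shows "\<alpha> \<in> MO_set m \<longleftrightarrow>
    (\<forall>n\<ge>1. \<forall>x. \<alpha> * ((\<Sum>j=1..n. x j) ^ m - power_sum n m x) \<le> tail_power_sum n m x)"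
  using assms by (simp add: MO_set_def tensor_pos_semidef_def tensor_form_MN)

text \<open>Testing with (1/2, 1/2) in dimension 2 gives total 1, power sum \<open>2 * q\<close> and
  tail power sum \<open>1 + q\<close>, where \<open>q\<close> \<le> 1/4.\<close>

lemma MO_set_le:
  assumes "\<alpha> \<in> MO_set m" "m \<ge> 2"
  shows "\<alpha> \<le> 3"
proof -
  define q where "q = (1 / 2 :: real) ^ m"
  have q: "0 < q" "q \<le> 1 / 4"
    using power_decreasing[of 2 m "1 / 2 :: real"] assms(2) by (auto simp: q_def power2_eq_square)
  have "\<alpha> * ((\<Sum>j=1..2::nat. 1 / 2) ^ m - power_sum 2 m (\<lambda>_. 1 / 2)) \<le> tail_power_sum 2 m (\<lambda>_. 1 / 2)"
    using assms by (intro MO_set_iff[THEN iffD1, rule_format]) auto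
  then have "\<alpha> * (1 - 2 * q) \<le> 1 + q"
    by (simp add: power_sum_def tail_power_sum_def q_def numeral_2_eq_2)
  moreover have "1 + q \<le> 3 * (1 - 2 * q)" using q by simp
  ultimately have "\<alpha> * (1 - 2 * q) \<le> 3 * (1 - 2 * q)" by linarith
  then show ?thesis using q by (simp only: mult_le_cancel_right)
qed

text \<open>Since \<open>s\<close> = \<open>x 1 + r\<close>, one of the two summands has modulus at
  least half that of \<open>s\<close>. A large \<open>r\<close> makes the second tail contribute
  \<open>q * s ^ m\<close>. A large \<open>x 1\<close> makes the power sum at least
  \<open>q * s ^ m\<close>, and \<open>(1 + q) * (1 - q)\<close> \<le> 1.\<close>

lemma one_plus_half_power_in_MO_set:
  assumes m: "m \<ge> 1" "even m"
  shows "1 + (1 / 2) ^ m \<in> MO_set m"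
  unfolding MO_set_iff[OF m(1)]
proof (intro allI impI)
  fix n :: nat and x :: "nat \<Rightarrow> real"
  assume n: "n \<ge> 1"
  define q where "q = (1 / 2 :: real) ^ m"
  define s where "s = (\<Sum>j=1..n. x j)"
  define r where "r = (\<Sum>j=2..n. x j)"
  have q: "q > 0" by (simp add: q_def)
  have x1: "x 1 = s - r"
    using n by (simp add: s_def r_def sum.atLeast_Suc_atMost numeral_2_eq_2)
  have half: "q * s ^ m \<le> z ^ m" if "\<bar>s\<bar> / 2 \<le> \<bar>z\<bar>" for z
  proof -
    have "(\<bar>s\<bar> / 2) ^ m \<le> \<bar>z\<bar> ^ m" using that by (intro power_mono) auto
    then show ?thesis using m by (simp add: q_def power_divide power_even_abs)
  qed
  have s: "s ^ m \<ge> 0" using m by (simp add: zero_le_even_power)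
  have P: "power_sum n m x \<ge> x 1 ^ m"
    unfolding power_sum_def using n m by (intro member_le_sum) auto
  have T: "tail_power_sum n m x \<ge> s ^ m"
    unfolding tail_power_sum_def s_def using n m
    by (intro member_le_sum[of 1 _ "\<lambda>k. (\<Sum>j=k..n. x j) ^ m"]) auto
  show "(1 + (1 / 2) ^ m) * ((\<Sum>j=1..n. x j) ^ m - power_sum n m x) \<le> tail_power_sum n m x"
    unfolding s_def[symmetric] q_def[symmetric]
  proof (cases "\<bar>s\<bar> / 2 \<le> \<bar>r\<bar>")
    case True
    have "s ^ m + r ^ m \<le> tail_power_sum n m x"
    proof (cases "n \<ge> 2")
      case True
      have "(\<Sum>k\<in>{1,2}. (\<Sum>j=k..n. x j) ^ m) \<le> tail_power_sum n m x"
        unfolding tail_power_sum_def using True m by (intro sum_mono2) auto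
      then show ?thesis by (simp add: s_def r_def)
    next
      case False
      then show ?thesis using T m by (simp add: r_def power_0_left)
    qed
    moreover have "(1 + q) * (s ^ m - power_sum n m x) \<le> (1 + q) * s ^ m"
      using q power_sum_nonneg[OF m(2), of n x] by (intro mult_left_mono) auto
    ultimately show "(1 + q) * (s ^ m - power_sum n m x) \<le> tail_power_sum n m x"
      using half[OF True] by (simp add: algebra_simps)
  next
    case False
    then have "q * s ^ m \<le> x 1 ^ m" by (intro half) (use x1 in linarith)
    then have "(1 + q) * (s ^ m - power_sum n m x) \<le> (1 + q) * (s ^ m - q * s ^ m)"
      using P q by (intro mult_left_mono) auto
    also have "\<dots> = s ^ m - q * q * s ^ m" by (simp add: algebra_simps)
    also have "\<dots> \<le> s ^ m" using s q by simp
    finally show "(1 + q) * (s ^ m - power_sum n m x) \<le> tail_power_sum n m x" using T by simp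
  qed
qed

lemma bdd_above_MO_set: "m \<ge> 2 \<Longrightarrow> bdd_above (MO_set m)"
  using MO_set_le by (meson bdd_aboveI)

lemma sup_MO_value_gt_1:
  assumes "m \<ge> 2" "even m"
  shows "sup_MO_value m > 1"
proof -
  have "1 + (1 / 2) ^ m \<le> sup_MO_value m"
    unfolding sup_MO_value_def
    using assms one_plus_half_power_in_MO_set bdd_above_MO_set by (intro cSup_upper) auto
  then show ?thesis by (rule less_le_trans[rotated]) simp
qed

text \<open>Each condition on \<alpha> is a non-strict linear inequality, so the MO set is an
  intersection of closed sets and contains its supremum.\<close>

lemma sup_MO_value_in_MO_set:
  assumes "m \<ge> 2" "even m"
  shows "sup_MO_value m \<in> MO_set m"
proof -
  have m: "m \<ge> 1" using assms by simp
  have ne: "MO_set m \<noteq> {}" using one_plus_half_power_in_MO_set[OF m assms(2)] by auto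
  have "MO_set m = (\<Inter>n\<in>{1..}. \<Inter>x.
      {\<alpha>. \<alpha> * ((\<Sum>j=1..n. x j) ^ m - power_sum n m x) \<le> tail_power_sum n m x})"
    using MO_set_iff[OF m] by auto
  also have "closed \<dots>"
    by (intro closed_INT ballI closed_Collect_le continuous_intros)
  finally show ?thesis
    unfolding sup_MO_value_def using ne bdd_above_MO_set[OF assms(1)]
    by (intro closed_contains_Sup)
qed

text \<open>This test vector bounds every smallest H-eigenvalue by 1.\<close>

lemma tensor_form_MN_one_coordinate:
  assumes "n \<ge> 1" "m \<ge> 1"
  shows "tensor_form n m (MN_tensor \<alpha>) (\<lambda>i. of_bool (i = 1)) = 1"
    "power_sum n m (\<lambda>i. of_bool (i = 1)) = 1"
  using assms(1)
proof (induction n rule: dec_induct)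
  case base
  case 1 show ?case using assms by (simp add: tensor_form_MN power_sum_def tail_power_sum_def)
  case 2 show ?case using assms by (simp add: power_sum_def)
next
  case (step n)
  case 1 show ?case using step assms by (subst tensor_form_MN_Suc_zero) auto
  case 2 show ?case using step assms by (subst tensor_form_MN_Suc_zero) auto
qed

section \<open>Enlarging an MO value under a uniform eigenvalue bound\<close>

text \<open>The smallness hypothesis bounds every coordinate by \<open>d\<close>, so dropping fewer
  than \<open>K\<close> of them changes the total by at most half its modulus. Hence each of the
  first \<open>K\<close> tails keeps at least half.\<close>

lemma tail_power_sum_large:
  fixes x :: "nat \<Rightarrow> real" and n K :: nat
  defines "s \<equiv> (\<Sum>j=1..n. x j)"
  assumes m: "m \<ge> 1" "even m" and K: "K \<ge> 1" and s: "s \<noteq> 0"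
    and small: "power_sum n m x < (1 / (2 * real K)) ^ m * s ^ m"
  shows "real K * (1 / 2) ^ m * s ^ m \<le> tail_power_sum n m x"
proof -
  define d where "d = \<bar>s\<bar> / (2 * real K)"
  have xd: "\<bar>x i\<bar> \<le> d" if "i \<in> {1..n}" for i
  proof -
    have "x i ^ m \<le> power_sum n m x"
      unfolding power_sum_def using that m by (intro member_le_sum) auto
    then have "\<bar>x i\<bar> ^ m < d ^ m"
      using small m by (simp add: d_def power_divide power_mult_distrib power_even_abs)
    then show ?thesis
      by (rule less_imp_le[OF power_less_imp_less_base]) (simp add: d_def)
  qed
  have tail: "\<bar>s\<bar> / 2 \<le> \<bar>\<Sum>j=k..n. x j\<bar>" if k: "1 \<le> k" "k \<le> K" "k \<le> Suc n" for k
  proof -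
    have "s = (\<Sum>j\<in>{1..<k}. x j) + (\<Sum>j=k..n. x j)"
    proof -
      have "{1..n} = {1..<k} \<union> {k..n}" using k by auto
      then show ?thesis unfolding s_def by (simp add: sum.union_disjoint ivl_disj_int)
    qed
    moreover have "\<bar>\<Sum>j\<in>{1..<k}. x j\<bar> \<le> (\<Sum>j\<in>{1..<k}. d)"
      by (rule order_trans[OF sum_abs sum_mono[OF xd]]) (use k in auto)
    moreover have "(\<Sum>j\<in>{1..<k}. d) = real (k - 1) * d" by simp
    moreover have "real (k - 1) * d \<le> real K * d"
      using k by (intro mult_right_mono) (auto simp: d_def)
    moreover have "real K * d = \<bar>s\<bar> / 2" using K by (simp add: d_def)
    ultimately show ?thesis by linarith
  qed
  have "K \<le> n"
  proof (rule ccontr)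
    assume "\<not> K \<le> n"
    then show False using tail[of "Suc n"] s by simp
  qed
  have "real K * (1 / 2) ^ m * s ^ m = (\<Sum>k=1..K. (\<bar>s\<bar> / 2) ^ m)"
    using m by (simp add: power_divide power_even_abs)
  also have "\<dots> \<le> (\<Sum>k=1..K. (\<Sum>j=k..n. x j) ^ m)"
  proof (rule sum_mono)
    fix k assume "k \<in> {1..K}"
    then have "(\<bar>s\<bar> / 2) ^ m \<le> \<bar>\<Sum>j=k..n. x j\<bar> ^ m"
      using tail[of k] \<open>K \<le> n\<close> by (intro power_mono) auto
    then show "(\<bar>s\<bar> / 2) ^ m \<le> (\<Sum>j=k..n. x j) ^ m" using m by (simp add: power_even_abs)
  qed
  also have "\<dots> \<le> tail_power_sum n m x"
    unfolding tail_power_sum_def using \<open>K \<le> n\<close> m by (intro sum_mono2) auto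
  finally show ?thesis .
qed

lemma MO_set_increase:
  assumes m: "m \<ge> 2" "even m" and \<alpha>: "\<alpha> \<le> 3" and L: "L > 0"
    and bound: "\<And>n x. n \<ge> 1 \<Longrightarrow> L * power_sum n m x \<le> tensor_form n m (MN_tensor \<alpha>) x"
  obtains \<delta> where "\<delta> > 0" "\<alpha> + \<delta> \<in> MO_set m"
proof -
  have m1: "m \<ge> 1" using m by simp
  \<comment> \<open>This many tails of modulus at least half the total contribute
    \<open>4 * s ^ m\<close>, and 4 bounds \<alpha> + \<delta> because \<alpha> \<le> 3 and \<delta>
    \<le> 1.\<close>
  define K where "K = (4 * 2 ^ m :: nat)"
  define \<epsilon> where "\<epsilon> = (1 / (2 * real K)) ^ m"
  define \<delta> where "\<delta> = min 1 (L * \<epsilon>)"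
  have \<epsilon>: "\<epsilon> > 0" by (simp add: \<epsilon>_def K_def)
  have K: "real K * (1 / 2) ^ m = 4" "K \<ge> 1" by (simp_all add: K_def power_divide)
  have "(\<alpha> + \<delta>) * ((\<Sum>j=1..n. x j) ^ m - power_sum n m x) \<le> tail_power_sum n m x"
    if n: "n \<ge> 1" for n x
  proof -
    define s where "s = (\<Sum>j=1..n. x j)"
    define N where "N = s ^ m - power_sum n m x"
    have P: "power_sum n m x \<ge> 0" using m by (simp add: power_sum_nonneg)
    then have N: "N \<le> s ^ m" by (simp add: N_def)
    have B: "L * power_sum n m x \<le> tail_power_sum n m x - \<alpha> * N"
      using bound[OF n, of x] m1 by (simp add: tensor_form_MN N_def s_def)
    have "(\<alpha> + \<delta>) * N \<le> tail_power_sum n m x"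
    proof (cases "N \<le> 0")
      case True
      then have "\<delta> * N \<le> 0"
        using L \<epsilon> by (intro mult_nonneg_nonpos) (auto simp: \<delta>_def)
      moreover have "0 \<le> L * power_sum n m x" using L P by simp
      ultimately show ?thesis using B by (simp add: algebra_simps)
    next
      case False
      show ?thesis
      proof (cases "power_sum n m x < \<epsilon> * s ^ m")
        case True
        have "s \<noteq> 0" using False N m1 by (auto simp: power_0_left)
        then have "4 * s ^ m \<le> tail_power_sum n m x"
          using tail_power_sum_large[OF m1 m(2) K(2), where n = n and x = x] True K(1)
          by (simp add: s_def \<epsilon>_def)
        moreover have "(\<alpha> + \<delta>) * N \<le> 4 * N"
          using False \<alpha> by (intro mult_right_mono) (auto simp: \<delta>_def)
        ultimately show ?thesis using N by linarith
      next
        case False': False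
        \<comment> \<open>The power sum is now at least \<open>\<epsilon> * s ^ m\<close>, so the
          slack \<open>L * power_sum n m x\<close> in \<open>B\<close> pays for \<delta>.\<close>
        have "\<delta> * N \<le> L * \<epsilon> * N" using False by (intro mult_right_mono) (auto simp: \<delta>_def)
        also have "\<dots> \<le> L * \<epsilon> * s ^ m" using N L \<epsilon> by (intro mult_left_mono) auto
        also have "\<dots> \<le> L * power_sum n m x" using False' L by simp
        finally show ?thesis using B by (simp add: algebra_simps)
      qed
    qed
    then show ?thesis by (simp add: N_def s_def)
  qed
  then have "\<alpha> + \<delta> \<in> MO_set m" using MO_set_iff[OF m1] by blast
  moreover have "\<delta> > 0" using L \<epsilon> by (simp add: \<delta>_def)
  ultimately show ?thesis by (rule that[rotated])
qed

section \<open>Positive definiteness, strict decrease and the limit\<close>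

theorem theorem3p7:
  fixes m :: nat
  assumes "m \<ge> 4" and "even m"
  shows "strict_antimono_on {1..} (\<lambda>n. min_H_eigenvalue n m (sup_MO_tensor m))
    \<and> (\<lambda>n. min_H_eigenvalue n m (sup_MO_tensor m)) \<longlonglongrightarrow> 0
    \<and> (\<forall>n\<ge>1. tensor_pos_def n m (sup_MO_tensor m))"
proof -
  define \<alpha> where "\<alpha> = sup_MO_value m"
  define l where "l = (\<lambda>n. min_H_eigenvalue n m (MN_tensor \<alpha>))"
  have m: "m \<ge> 1" "m \<ge> 2" "even m" using assms by auto
  have \<alpha>1: "\<alpha> > 1" unfolding \<alpha>_def using m by (intro sup_MO_value_gt_1)
  have \<alpha>_MO: "\<alpha> \<in> MO_set m" unfolding \<alpha>_def using m by (intro sup_MO_value_in_MO_set)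
  have le_form: "l n * power_sum n m y \<le> tensor_form n m (MN_tensor \<alpha>) y"
    and ex: "\<exists>x. nonzero_vec n x \<and> tensor_form n m (MN_tensor \<alpha>) x = l n * power_sum n m x"
    if "n \<ge> 1" for n y
    unfolding l_def using min_H_eigenvalue_MN[OF that m(1,3)] by auto
  \<comment> \<open>Descent with \<open>l\<close> = 0: a form value of at most 0 would produce a
    negative one in dimension \<open>Suc n\<close>.\<close>
  have pos: "tensor_form n m (MN_tensor \<alpha>) x > 0" if n: "n \<ge> 1" "nonzero_vec n x" for n x
  proof -
    obtain y where "tensor_form (Suc n) m (MN_tensor \<alpha>) y < tensor_form n m (MN_tensor \<alpha>) x"
      using tensor_form_descent[OF n(2), of 0 \<alpha> m] \<alpha>1 m by auto
    moreover have "tensor_form (Suc n) m (MN_tensor \<alpha>) y \<ge> 0"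
      using \<alpha>_MO by (simp add: MO_set_def tensor_pos_semidef_def)
    ultimately show ?thesis by simp
  qed
  have l_pos: "l n > 0" if "n \<ge> 1" for n
    using ex[OF that] pos[OF that] power_sum_nonneg[OF m(3)]
    by (metis zero_less_mult_pos2 mult_eq_0_iff order_less_le)
  have l_Suc: "l (Suc n) < l n" if n: "n \<ge> 1" for n
  proof -
    obtain x where x: "nonzero_vec n x" "tensor_form n m (MN_tensor \<alpha>) x = l n * power_sum n m x"
      using ex[OF n] by auto
    \<comment> \<open>Together with \<alpha> > 1 this gives \<open>l n\<close> < \<alpha>, as the
      descent requires.\<close>
    have "l n \<le> 1"
      using le_form[OF n, of "\<lambda>i. of_bool (i = 1)"] tensor_form_MN_one_coordinate[OF n m(1)] by simp
    then obtain y where "tensor_form (Suc n) m (MN_tensor \<alpha>) y - l n * power_sum (Suc n) m y < 0"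
      using tensor_form_descent[OF x(1), of "l n" \<alpha> m] \<alpha>1 m x(2) by auto
    then have "l (Suc n) * power_sum (Suc n) m y < l n * power_sum (Suc n) m y"
      using le_form[of "Suc n" y] by simp
    then show ?thesis
      using power_sum_nonneg[OF m(3), of "Suc n" y] by (simp add: mult_less_cancel_right)
  qed
  have mono: "l k < l n" if "1 \<le> n" "n < k" for n k
    using that(2)
  proof (induction k)
    case (Suc k)
    then show ?case
      using l_Suc[of k] \<open>1 \<le> n\<close> by (cases "n = k") auto
  qed simp
  have small: "\<exists>n\<ge>1. l n < e" if "e > 0" for e
  proof (rule ccontr)
    assume "\<not> (\<exists>n\<ge>1. l n < e)"
    then have e: "e \<le> l n" if "n \<ge> 1" for n using that by force
    have "e * power_sum n m x \<le> tensor_form n m (MN_tensor \<alpha>) x" if "n \<ge> 1" for n x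
      using mult_right_mono[OF e[OF that] power_sum_nonneg[OF m(3)]] le_form[OF that] order_trans
      by blast
    then obtain \<delta> where "\<delta> > 0" "\<alpha> + \<delta> \<in> MO_set m"
      using MO_set_increase[OF m(2,3) MO_set_le[OF \<alpha>_MO m(2)] \<open>e > 0\<close>] by blast
    \<comment> \<open>An MO value above \<alpha> contradicts the choice of \<alpha> as
      supremum.\<close>
    then show False
      using cSup_upper[OF _ bdd_above_MO_set[OF m(2)]] by (force simp: \<alpha>_def sup_MO_value_def)
  qed
  have "l \<longlonglongrightarrow> 0"
  proof (rule LIMSEQ_I)
    fix e :: real assume "e > 0"
    then obtain n where n: "n \<ge> 1" "l n < e" using small by blast
    have "norm (l k - 0) < e" if "k \<ge> n" for k
      using mono[OF n(1), of k] l_pos[of k] n that by (cases "k = n") auto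
    then show "\<exists>n. \<forall>k\<ge>n. norm (l k - 0) < e" by blast
  qed
  moreover have "strict_antimono_on {1..} l"
    using mono by (auto simp: monotone_on_def)
  ultimately show ?thesis
    using pos by (simp add: l_def \<alpha>_def sup_MO_tensor_def tensor_pos_def_def)
qed

end
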